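(* Let $G^{\mathfrak C}$ be a coupled graph. Then $\operatorname{M}_{\operatorname{Sp}}(G^{\mathfrak C})\le \operatorname{Z}_{\operatorname{C}}(G^{\mathfrak C})$.
   Context: $\Omega=\begin{bmatrix}O&I_p\\-I_p&O\end{bmatrix}$; a real $2p\times2p$ matrix $S$ is symplectic if $S^\top\Omega S=\Omega$. Positive definite matrices are real symmetric. By Williamson's theorem, for each $2p\times 2p$ positive definite $N$ there is a symplectic $S$ with $S^\top NS=D\oplus D$, $D$ a $p\times p$ diagonal matrix whose diagonal entries are positive and unique up to order; these are the symplectic eigenvalues of $N$, and the multiplicity of a symplectic eigenvalue is its number of occurrences on the diagonal of $D$. Graphs are simple, undirected, finite. A coupled graph $G^{\mathfrak C}$ is a graph $G$ of order $2p$ together with a coupling $\mathfrak C$, i.e. a partition of $V(G)$ into $p$ (unordered) pairs; $\mathfrak c(v)$ denotes the vertex paired with $v$ (paired vertices need not be adjacent). A representative labeling $L$ of $G^{\mathfrak C}$ is a bijective labeling of $V(G)$ by $1,\dots,2p$ such that each pair of $\mathfrak C$ receives labels $\{k,k+p\}$ for some $k\in\{1,\dots,p\}$. $\mathcal S_+(G^L)$ is the set of positive definite matrices $[n_{ij}]$ such that for $i\neq j$, $n_{ij}\ne0$ if and only if the vertices labeled $i$ and $j$ are adjacent. $\operatorname{M}_{\operatorname{Sp}}(G^{\mathfrak C})$ is the maximum multiplicity among the symplectic eigenvalues of matrices $N\in\mathcal S_+(G^L)$, for a representative labeling $L$ (it does not depend on the choice of $L$). Coupled zero forcing: each vertex is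 blue or white; the coupled color change rule is: (1) a blue vertex $v$ forces a white vertex $w$ to become blue if $w$ is the only white vertex in $N(v)\cup\{\mathfrak c(v)\}$; (2) a white vertex $v$ becomes blue if every vertex in $N(v)\cup\{\mathfrak c(v)\}$ is blue. Here $N(v)$ is the open neighborhood of $v$ in $G$. A set of initially blue vertices is a coupled zero forcing set if repeated application of this rule eventually colors all vertices blue. $\operatorname{Z}_{\operatorname{C}}(G^{\mathfrak C})$ is the minimum cardinality of a coupled zero forcing set. *)

theory Defs
  imports
    "Graph_Theory.Pair_Digraph"
    "Jordan_Normal_Form.Matrix"
    "HOL-Library.Disjoint_Sets"
begin

section \<open>Coupled graphs\<close>

text \<open>
  A simple undirected finite graph is a \<^locale>\<open>pair_graph\<close>: the arc relation \<^const>\<open>parcs\<close> is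
  finite, symmetric and irreflexive. A coupling \<open>C\<close> is a partition of the vertex set into two-element
  sets, so the graph has order \<open>2 * p\<close> for \<open>p = card C\<close>.
\<close>

definition coupled_graph :: "'a pair_pre_digraph \<Rightarrow> 'a set set \<Rightarrow> bool" where
  "coupled_graph G C \<longleftrightarrow>
     pair_graph G \<and> partition_on (pverts G) C \<and> (\<forall>P\<in>C. card P = 2)"

definition partner :: "'a set set \<Rightarrow> 'a \<Rightarrow> 'a" where
  "partner C v = (THE w. w \<noteq> v \<and> {v, w} \<in> C)"

text \<open>
  Labels are \<open>0, \<dots>, 2p - 1\<close> instead of \<open>1, \<dots>, 2p\<close>, to agree with the indices of \<^typ>\<open>real mat\<close>.
\<close>

definition representative_labeling ::
  "'a pair_pre_digraph \<Rightarrow> 'a set set \<Rightarrow> ('a \<Rightarrow> nat) \<Rightarrow> bool" where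
  "representative_labeling G C L \<longleftrightarrow>
     bij_betw L (pverts G) {..<2 * card C} \<and>
     (\<forall>P\<in>C. \<exists>k<card C. L ` P = {k, k + card C})"


section \<open>Symplectic eigenvalues\<close>

definition Omega :: "nat \<Rightarrow> real mat" where
  "Omega p = four_block_mat (0\<^sub>m p p) (1\<^sub>m p) (- 1\<^sub>m p) (0\<^sub>m p p)"

definition symplectic :: "nat \<Rightarrow> real mat \<Rightarrow> bool" where
  "symplectic p S \<longleftrightarrow>
     S \<in> carrier_mat (2 * p) (2 * p) \<and> transpose_mat S * Omega p * S = Omega p"

definition positive_definite :: "nat \<Rightarrow> real mat \<Rightarrow> bool" where
  "positive_definite n N \<longleftrightarrow>
     N \<in> carrier_mat n n \<and> transpose_mat N = N \<and>
     (\<forall>v\<in>carrier_vec n. v \<noteq> 0\<^sub>v n \<longrightarrow> v \<bullet> (N *\<^sub>v v) > 0)"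

definition williamson_form :: "nat \<Rightarrow> real mat \<Rightarrow> real mat \<Rightarrow> bool" where
  "williamson_form p N D \<longleftrightarrow>
     D \<in> carrier_mat p p \<and> diagonal_mat D \<and> (\<forall>i<p. D $$ (i, i) > 0) \<and>
     (\<exists>S. symplectic p S \<and>
          transpose_mat S * N * S = four_block_mat D (0\<^sub>m p p) (0\<^sub>m p p) D)"

text \<open>
  \<open>symplectic_eigenvalue_mult p N l m\<close>: \<open>l\<close> is a symplectic eigenvalue of \<open>N\<close> with multiplicity \<open>m\<close>.
  By the uniqueness part of Williamson's theorem, \<open>m\<close> does not depend on the choice of \<open>D\<close>.
\<close>

definition symplectic_eigenvalue_mult :: "nat \<Rightarrow> real mat \<Rightarrow> real \<Rightarrow> nat \<Rightarrow> bool" where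
  "symplectic_eigenvalue_mult p N l m \<longleftrightarrow>
     (\<exists>D. williamson_form p N D \<and> l \<in> set (diag_mat D) \<and> m = count_list (diag_mat D) l)"

definition S_plus :: "'a pair_pre_digraph \<Rightarrow> 'a set set \<Rightarrow> ('a \<Rightarrow> nat) \<Rightarrow> real mat set" where
  "S_plus G C L =
     {N. positive_definite (2 * card C) N \<and>
         (\<forall>u\<in>pverts G. \<forall>v\<in>pverts G. u \<noteq> v \<longrightarrow>
            (N $$ (L u, L v) \<noteq> 0 \<longleftrightarrow> (u, v) \<in> parcs G))}"

text \<open>
  The set of multiplicities is bounded by \<open>p\<close> (see below) and, for \<open>p > 0\<close>, nonempty by Williamson's
  theorem, so that its \<^const>\<open>Sup\<close> in \<^typ>\<open>nat\<close> is its maximum. For the empty graph it is \<open>0\<close>.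
\<close>

definition M_Sp :: "'a pair_pre_digraph \<Rightarrow> 'a set set \<Rightarrow> ('a \<Rightarrow> nat) \<Rightarrow> nat" where
  "M_Sp G C L = Sup {m. \<exists>N\<in>S_plus G C L. \<exists>l. symplectic_eigenvalue_mult (card C) N l m}"

lemma symplectic_eigenvalue_mult_le:
  assumes "symplectic_eigenvalue_mult p N l m"
  shows "m \<le> p"
proof -
  obtain D where "dim_row D = p" "m = count_list (diag_mat D) l"
    using assms by (auto simp: symplectic_eigenvalue_mult_def williamson_form_def)
  then show ?thesis
    using count_le_length[of "diag_mat D" l] by (simp add: diag_mat_def)
qed


section \<open>Coupled zero forcing\<close>

definition coupled_nbhd :: "'a pair_pre_digraph \<Rightarrow> 'a set set \<Rightarrow> 'a \<Rightarrow> 'a set" where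
  "coupled_nbhd G C v = {w. (v, w) \<in> parcs G} \<union> {partner C v}"

text \<open>One application of the coupled color change rule to a set \<open>B\<close> of blue vertices.\<close>

inductive color_change :: "'a pair_pre_digraph \<Rightarrow> 'a set set \<Rightarrow> 'a set \<Rightarrow> 'a set \<Rightarrow> bool"
  for G :: "'a pair_pre_digraph" and C :: "'a set set" where
  force_neighbor: "color_change G C B (insert w B)"
    if "v \<in> pverts G" "v \<in> B" "coupled_nbhd G C v - B = {w}"
| force_self: "color_change G C B (insert v B)"
    if "v \<in> pverts G" "v \<notin> B" "coupled_nbhd G C v \<subseteq> B"

definition coupled_zero_forcing_set ::
  "'a pair_pre_digraph \<Rightarrow> 'a set set \<Rightarrow> 'a set \<Rightarrow> bool" where
  "coupled_zero_forcing_set G C B \<longleftrightarrow>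
     B \<subseteq> pverts G \<and> (color_change G C)\<^sup>*\<^sup>* B (pverts G)"

definition Z_C :: "'a pair_pre_digraph \<Rightarrow> 'a set set \<Rightarrow> nat" where
  "Z_C G C = Min (card ` {B. coupled_zero_forcing_set G C B})"

end

theory Submission
  imports Defs "Jordan_Normal_Form.Determinant"
begin

text \<open>
  Let \<open>N\<close> have symplectic eigenvalue \<open>l\<close> with multiplicity \<open>m\<close>. The Hermitian matrix
  \<open>A = N + \<i> l \<Omega>\<close> then has complex nullity at least \<open>m\<close>: if \<open>S\<close> brings \<open>N\<close> to Williamson form
  \<open>D \<oplus> D\<close> and \<open>c\<close> is supported where the diagonal of \<open>D\<close> equals \<open>l\<close>, then
  \<open>z = S (c, \<i> c)\<close> satisfies \<open>A z = 0\<close>, because \<open>\<Omega> (c, \<i> c) = \<i> (c, \<i> c)\<close> and congruence by \<open>S\<close>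
  turns \<open>A\<close> into \<open>(D \<oplus> D) + \<i> l \<Omega>\<close> (lemma \<open>williamson_null_vector\<close>).

  Since \<open>N\<close> is real and \<open>l \<noteq> 0\<close>, the entry of \<open>A\<close> at two distinct vertices is nonzero exactly when
  they are adjacent or paired: the real part records adjacency and the imaginary part the coupling.
  The diagonal of \<open>A\<close> is that of the positive definite matrix \<open>N\<close>, hence nonzero. The coupled
  color change rule is thus what one reads off the rows of \<open>A z = 0\<close>: if \<open>z\<close> vanishes on the blue
  vertices, then row \<open>v\<close> has a single remaining term whenever \<open>v\<close> permits a force, and this
  term must vanish (lemma \<open>null_vector_color_change\<close>). A null vector that vanishes on a coupled zero
  forcing set \<open>B\<close> is therefore zero. If \<open>card B < m\<close>, however, counting dimensions gives a nonzero
  \<open>c\<close> as above such that \<open>z\<close> vanishes on \<open>B\<close>, and \<open>z \<noteq> 0\<close> because \<open>S\<close> is invertible.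
\<close>

section \<open>Null vectors of matrices\<close>

text \<open>Padding the system with zero equations makes it square and singular.\<close>

lemma underdetermined_system_nontrivial_solution:
  fixes R :: "'a :: idom vec set"
  assumes "finite R" and R: "R \<subseteq> carrier_vec n" and "card R < n"
  obtains c where "c \<in> carrier_vec n" "c \<noteq> 0\<^sub>v n" "\<forall>r\<in>R. r \<bullet> c = 0"
proof -
  obtain rs where rs: "set rs = R" "distinct rs"
    using finite_distinct_list[OF \<open>finite R\<close>] by blast
  then have len: "length rs < n"
    using \<open>card R < n\<close> by (metis distinct_card)
  define M where "M = mat_of_rows n (rs @ replicate (n - length rs) (0\<^sub>v n))"
  have M: "M \<in> carrier_mat n n"
    using len by (auto simp: M_def)
  \<comment> \<open>The last row of \<open>M\<close> is one of the padding zeros, so \<open>M\<^sup>T\<close> kills the last unit vector.\<close>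
  have "transpose_mat M *\<^sub>v unit_vec n (n - 1) = 0\<^sub>v n"
  proof -
    have "row M (n - 1) = 0\<^sub>v n"
      unfolding M_def using len by (subst mat_of_rows_row) (auto simp: nth_append)
    moreover have "M $$ (n - 1, i) = 0" if "row M (n - 1) = 0\<^sub>v n" "i < n" for i
      using arg_cong[OF that(1), of "\<lambda>v. v $ i"] M len that(2) by simp
    ultimately show ?thesis
      using M len by (auto intro!: eq_vecI)
  qed
  moreover have "unit_vec n (n - 1) \<noteq> (0\<^sub>v n :: 'a vec)"
    using len by simp
  moreover have "unit_vec n (n - 1) \<in> carrier_vec n"
    by simp
  ultimately have "det (transpose_mat M) = 0"
    using M unfolding det_0_iff_vec_prod_zero[OF transpose_carrier_mat[THEN iffD2, OF M]] by blast
  then obtain c where c: "c \<in> carrier_vec n" "c \<noteq> 0\<^sub>v n" "M *\<^sub>v c = 0\<^sub>v n"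
    using det_0_iff_vec_prod_zero[OF M] det_transpose[OF M] by auto
  have "r \<bullet> c = 0" if r: "r \<in> R" for r
  proof -
    obtain i where i: "i < length rs" "rs ! i = r"
      using r rs(1) by (metis in_set_conv_nth)
    have "r \<in> carrier_vec n" using r R by blast
    then have "row M i = r"
      unfolding M_def using i len by (subst mat_of_rows_row) (auto simp: nth_append)
    then show ?thesis
      using arg_cong[OF c(3), of "\<lambda>v. v $ i"] i len M by simp
  qed
  then show thesis using that c by blast
qed

lemma mult_mat_vec_eq_0_imp_eq_0:
  fixes A :: "'a :: idom mat"
  assumes "A \<in> carrier_mat n n" "det A \<noteq> 0" "v \<in> carrier_vec n" "A *\<^sub>v v = 0\<^sub>v n"
  shows "v = 0\<^sub>v n"
  using assms det_0_iff_vec_prod_zero by blast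


section \<open>Symplectic matrices and the Williamson form\<close>

lemma Omega_carrier [simp]: "Omega p \<in> carrier_mat (2 * p) (2 * p)"
  by (auto simp: Omega_def mult_2)

lemma dim_Omega [simp]: "dim_row (Omega p) = 2 * p" "dim_col (Omega p) = 2 * p"
  using Omega_carrier by blast+

lemma Omega_nonzero_iff:
  assumes "i < 2 * p" "j < 2 * p"
  shows "Omega p $$ (i, j) \<noteq> 0 \<longleftrightarrow> j = i + p \<or> i = j + p"
  using assms by (auto simp: Omega_def)

lemma det_Omega_nonzero: "det (Omega p) \<noteq> 0"
proof -
  have "Omega p * Omega p = four_block_mat (- 1\<^sub>m p) (0\<^sub>m p p) (0\<^sub>m p p) (- 1\<^sub>m p)"
    unfolding Omega_def by (subst mult_four_block_mat[where ?nr1.0=p and ?nc1.0=p and ?nr2.0=p and ?nc2.0=p]) auto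
  also have "\<dots> = - 1\<^sub>m (2 * p)"
    by (intro eq_matI) auto
  finally have "Omega p * (- Omega p) = 1\<^sub>m (2 * p)"
    using uminus_mult_right_mat[of "Omega p" "Omega p"]
    by (simp add: uminus_uminus_mat)
  then have "det (Omega p) * det (- Omega p) = 1"
    using det_mult[of "Omega p" "2 * p" "- Omega p"] by simp
  then show ?thesis by auto
qed

lemma det_symplectic_nonzero:
  assumes "symplectic p S"
  shows "det S \<noteq> 0"
proof
  assume "det S = 0"
  moreover have S: "S \<in> carrier_mat (2 * p) (2 * p)" "transpose_mat S * Omega p * S = Omega p"
    using assms by (auto simp: symplectic_def)
  have "det (transpose_mat S * Omega p * S) = det (transpose_mat S * Omega p) * det S"
    using S(1) by (intro det_mult) auto
  ultimately show False
    using S(2) det_Omega_nonzero by simp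
qed

text \<open>The vectors \<open>(c, \<i> c)\<close> form the eigenspace of \<open>\<Omega>\<close> for the eigenvalue \<open>\<i>\<close>.\<close>

lemma Omega_eigenvector:
  assumes "c \<in> carrier_vec p"
  shows "map_mat complex_of_real (Omega p) *\<^sub>v (c @\<^sub>v \<i> \<cdot>\<^sub>v c) = \<i> \<cdot>\<^sub>v (c @\<^sub>v \<i> \<cdot>\<^sub>v c)"
proof -
  have "map_mat complex_of_real (Omega p) =
      four_block_mat (0\<^sub>m p p) (1\<^sub>m p) (- 1\<^sub>m p) (0\<^sub>m p p)"
    by (intro eq_matI) (auto simp: Omega_def)
  moreover have "- 1\<^sub>m p *\<^sub>v c = - c"
    using assms by simp
  ultimately show ?thesis
    using assms by (auto simp: four_block_mat_mult_vec[of _ p p _ p _ p] intro!: eq_vecI)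
qed

text \<open>
  It suffices to verify the claim after multiplying by the invertible matrix \<open>S\<^sup>T\<close>; there \<open>S\<close>
  reduces \<open>N\<close> to \<open>D \<oplus> D\<close> and leaves \<open>\<Omega>\<close> as it is.
\<close>

lemma williamson_null_vector:
  fixes l :: real and c :: "complex vec"
  assumes S: "symplectic p S" and N: "N \<in> carrier_mat (2 * p) (2 * p)"
    and SNS: "transpose_mat S * N * S = four_block_mat D (0\<^sub>m p p) (0\<^sub>m p p) D"
    and D: "D \<in> carrier_mat p p" "diagonal_mat D"
    and c: "c \<in> carrier_vec p" "\<And>i. i < p \<Longrightarrow> D $$ (i, i) \<noteq> l \<Longrightarrow> c $ i = 0"
  shows "(map_mat complex_of_real N + (\<i> * complex_of_real l) \<cdot>\<^sub>m map_mat complex_of_real (Omega p)) *\<^sub>v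
           (map_mat complex_of_real S *\<^sub>v (c @\<^sub>v \<i> \<cdot>\<^sub>v c)) = 0\<^sub>v (2 * p)"
proof -
  let ?h = "map_mat complex_of_real"
  define w where "w = c @\<^sub>v \<i> \<cdot>\<^sub>v c"
  define z where "z = ?h S *\<^sub>v w"
  define A where "A = ?h N + (\<i> * complex_of_real l) \<cdot>\<^sub>m ?h (Omega p)"
  have Sc: "S \<in> carrier_mat (2 * p) (2 * p)" and SOS: "transpose_mat S * Omega p * S = Omega p"
    using S by (auto simp: symplectic_def)
  have w: "w \<in> carrier_vec (2 * p)"
    using c(1) by (auto simp: w_def mult_2)
  have z: "z \<in> carrier_vec (2 * p)"
    using Sc w by (auto simp: z_def)
  have A: "A \<in> carrier_mat (2 * p) (2 * p)"
    using N by (auto simp: A_def)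
  have congruence: "?h (transpose_mat S) *\<^sub>v (?h X *\<^sub>v z) = ?h (transpose_mat S * X * S) *\<^sub>v w"
    if X: "X \<in> carrier_mat (2 * p) (2 * p)" for X
  proof -
    have "?h (transpose_mat S * X * S) = ?h (transpose_mat S) * ?h X * ?h S"
      using Sc X by (simp add: of_real_hom.mat_hom_mult[of _ "2 * p" "2 * p" _ "2 * p"])
    then show ?thesis
      using Sc X w
      by (simp add: z_def assoc_mult_mat_vec[of _ "2 * p" "2 * p" _ "2 * p"])
  qed
  have Dc: "?h D *\<^sub>v (a \<cdot>\<^sub>v c) = complex_of_real l \<cdot>\<^sub>v (a \<cdot>\<^sub>v c)" for a
  proof (rule eq_vecI)
    fix i assume "i < dim_vec (complex_of_real l \<cdot>\<^sub>v (a \<cdot>\<^sub>v c))"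
    then have i: "i < p" using c(1) by simp
    have "(?h D *\<^sub>v (a \<cdot>\<^sub>v c)) $ i = (\<Sum>j\<in>{0..<p}. complex_of_real (D $$ (i, j)) * (a * c $ j))"
      using i D(1) c(1) by (auto simp: scalar_prod_def)
    also have "\<dots> = (\<Sum>j\<in>{0..<p}. if j = i then complex_of_real l * (a * c $ i) else 0)"
      using i D c(2) by (intro sum.cong) (auto simp: diagonal_mat_def)
    finally show "(?h D *\<^sub>v (a \<cdot>\<^sub>v c)) $ i = (complex_of_real l \<cdot>\<^sub>v (a \<cdot>\<^sub>v c)) $ i"
      using i c(1) by simp
  qed (use D(1) c(1) in auto)
  have DD: "?h (four_block_mat D (0\<^sub>m p p) (0\<^sub>m p p) D) *\<^sub>v w = complex_of_real l \<cdot>\<^sub>v w"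
  proof -
    have "?h (four_block_mat D (0\<^sub>m p p) (0\<^sub>m p p) D) =
        four_block_mat (?h D) (0\<^sub>m p p) (0\<^sub>m p p) (?h D)"
      using D(1) by (intro eq_matI) auto
    then have "?h (four_block_mat D (0\<^sub>m p p) (0\<^sub>m p p) D) *\<^sub>v w =
        ?h D *\<^sub>v c @\<^sub>v ?h D *\<^sub>v (\<i> \<cdot>\<^sub>v c)"
      using D(1) c(1) unfolding w_def by (simp add: mult_mat_vec_split)
    also have "\<dots> = complex_of_real l \<cdot>\<^sub>v w"
      using Dc[of 1] Dc[of \<i>] c(1) by (auto simp: w_def intro!: eq_vecI)
    finally show ?thesis .
  qed
  have "?h (transpose_mat S) *\<^sub>v (A *\<^sub>v z) =
      ?h (transpose_mat S) *\<^sub>v (?h N *\<^sub>v z) +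
      (\<i> * complex_of_real l) \<cdot>\<^sub>v (?h (transpose_mat S) *\<^sub>v (?h (Omega p) *\<^sub>v z))"
  proof -
    have "A *\<^sub>v z = ?h N *\<^sub>v z + (\<i> * complex_of_real l) \<cdot>\<^sub>v (?h (Omega p) *\<^sub>v z)"
      unfolding A_def using N z by (subst add_mult_distrib_mat_vec[of _ "2 * p" "2 * p"]) (auto intro!: eq_vecI)
    moreover have "?h N *\<^sub>v z \<in> carrier_vec (2 * p)" "?h (Omega p) *\<^sub>v z \<in> carrier_vec (2 * p)"
      using N by (intro carrier_vecI; simp)+
    moreover have "?h (transpose_mat S) \<in> carrier_mat (2 * p) (2 * p)"
      using Sc by simp
    ultimately show ?thesis
      by (simp add: mult_add_distrib_mat_vec[of _ "2 * p" "2 * p"] mult_mat_vec[of _ "2 * p" "2 * p"])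
  qed
  also have "\<dots> = complex_of_real l \<cdot>\<^sub>v w + (\<i> * complex_of_real l) \<cdot>\<^sub>v (\<i> \<cdot>\<^sub>v w)"
    using congruence[OF N] congruence[OF Omega_carrier] SNS SOS DD Omega_eigenvector[OF c(1)]
    by (simp add: w_def)
  also have "\<dots> = 0\<^sub>v (2 * p)"
    using w by (auto intro!: eq_vecI simp: algebra_simps)
  finally have "?h (transpose_mat S) *\<^sub>v (A *\<^sub>v z) = 0\<^sub>v (2 * p)" .
  moreover have "det (?h (transpose_mat S)) \<noteq> 0"
    using det_symplectic_nonzero[OF S] det_transpose[OF Sc] by (simp add: of_real_hom.hom_det)
  moreover have "?h (transpose_mat S) \<in> carrier_mat (2 * p) (2 * p)" "A *\<^sub>v z \<in> carrier_vec (2 * p)"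
    using Sc A z by auto
  ultimately have "A *\<^sub>v z = 0\<^sub>v (2 * p)"
    using mult_mat_vec_eq_0_imp_eq_0 by blast
  then show ?thesis
    by (simp add: A_def z_def w_def)
qed

text \<open>
  The support condition on \<open>c\<close> and the vanishing of \<open>z\<close> on \<open>K\<close> are \<open>p - m\<close> and at most \<open>card K\<close>
  linear equations for the \<open>p\<close> coordinates of \<open>c\<close>.
\<close>

lemma symplectic_eigenvalue_mult_null_vector:
  assumes mult: "symplectic_eigenvalue_mult p N l m"
    and N: "N \<in> carrier_mat (2 * p) (2 * p)"
    and K: "finite K" "K \<subseteq> {..<2 * p}" "card K < m"
  obtains z where "z \<in> carrier_vec (2 * p)" "z \<noteq> 0\<^sub>v (2 * p)" "\<forall>k\<in>K. z $ k = 0"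
    "(map_mat complex_of_real N + (\<i> * complex_of_real l) \<cdot>\<^sub>m map_mat complex_of_real (Omega p)) *\<^sub>v z
       = 0\<^sub>v (2 * p)"
proof -
  obtain D S where D: "D \<in> carrier_mat p p" "diagonal_mat D" and S: "symplectic p S"
    and SNS: "transpose_mat S * N * S = four_block_mat D (0\<^sub>m p p) (0\<^sub>m p p) D"
    and m: "m = count_list (diag_mat D) l"
    using mult by (auto simp: symplectic_eigenvalue_mult_def williamson_form_def)
  define T where "T = map_mat complex_of_real S"
  have Sc: "S \<in> carrier_mat (2 * p) (2 * p)"
    using S by (simp add: symplectic_def)
  then have T: "T \<in> carrier_mat (2 * p) (2 * p)"
    by (simp add: T_def)
  define J where "J = {i. i < p \<and> D $$ (i, i) \<noteq> l}"
  have "m = card {i. i < p \<and> D $$ (i, i) = l}"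
    using D(1) unfolding m count_list_eq_length_filter length_filter_conv_card
    by (auto simp: diag_mat_def intro!: arg_cong[of _ _ card])
  moreover have "{..<p} = {i. i < p \<and> D $$ (i, i) = l} \<union> J"
    by (auto simp: J_def)
  then have "card {..<p} = card {i. i < p \<and> D $$ (i, i) = l} + card J"
    by (simp only:) (rule card_Un_disjoint, auto simp: J_def)
  ultimately have mJ: "m + card J = p" by simp
  \<comment> \<open>\<open>r k\<close> is the linear form in \<open>c\<close> that gives the entry \<open>k\<close> of \<open>T (c, \<i> c)\<close>.\<close>
  define r where "r k = vec_first (row T k) p + \<i> \<cdot>\<^sub>v vec_last (row T k) p" for k
  define R where "R = r ` K \<union> unit_vec p ` J"
  have "card R \<le> card K + card J"
    unfolding R_def using K(1)
    by (intro card_Un_le[THEN order_trans] add_mono card_image_le) (auto simp: J_def)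
  then have "card R < p" using K(3) mJ by simp
  moreover have "finite R" "R \<subseteq> carrier_vec p"
    using K(1) by (auto simp: R_def J_def r_def)
  ultimately obtain c where c: "c \<in> carrier_vec p" "c \<noteq> 0\<^sub>v p" "\<forall>x\<in>R. x \<bullet> c = 0"
    using underdetermined_system_nontrivial_solution[of R p] by blast
  have supp: "c $ i = 0" if "i < p" "D $$ (i, i) \<noteq> l" for i
  proof -
    have "unit_vec p i \<in> R" using that by (auto simp: R_def J_def)
    then show ?thesis using c that by auto
  qed
  define z where "z = T *\<^sub>v (c @\<^sub>v \<i> \<cdot>\<^sub>v c)"
  show thesis
  proof
    show "z \<in> carrier_vec (2 * p)" using T by (intro carrier_vecI) (simp add: z_def)
    show "z \<noteq> 0\<^sub>v (2 * p)"
    proof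
      assume "z = 0\<^sub>v (2 * p)"
      moreover have "det T \<noteq> 0"
        using det_symplectic_nonzero[OF S] by (simp add: T_def of_real_hom.hom_det)
      moreover have "c @\<^sub>v \<i> \<cdot>\<^sub>v c \<in> carrier_vec (2 * p)"
        using c(1) by (simp add: mult_2)
      ultimately have "c @\<^sub>v \<i> \<cdot>\<^sub>v c = 0\<^sub>v (2 * p)"
        using mult_mat_vec_eq_0_imp_eq_0[OF T] by (simp add: z_def)
      also have "\<dots> = 0\<^sub>v p @\<^sub>v 0\<^sub>v p" by auto
      finally show False using c(1,2) by (subst (asm) append_vec_eq[of _ p]) auto
    qed
    show "\<forall>k\<in>K. z $ k = 0"
    proof
      fix k assume k: "k \<in> K"
      have "row T k \<in> carrier_vec (p + p)" using T by (intro carrier_vecI) simp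
      then have "row T k = vec_first (row T k) p @\<^sub>v vec_last (row T k) p"
        by (rule vec_first_last_append[symmetric])
      moreover have "z $ k = row T k \<bullet> (c @\<^sub>v \<i> \<cdot>\<^sub>v c)"
        using T K(2) k by (auto simp: z_def)
      ultimately have "z $ k =
          (vec_first (row T k) p @\<^sub>v vec_last (row T k) p) \<bullet> (c @\<^sub>v \<i> \<cdot>\<^sub>v c)"
        by simp
      also have "\<dots> = r k \<bullet> c"
        using c(1) unfolding r_def
        by (simp add: scalar_prod_append[of _ p _ p] add_scalar_prod_distrib[of _ p])
      also have "\<dots> = 0" using c(3) k by (auto simp: R_def)
      finally show "z $ k = 0" .
    qed
    show "(map_mat complex_of_real N + (\<i> * complex_of_real l) \<cdot>\<^sub>m map_mat complex_of_real (Omega p)) *\<^sub>v z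
       = 0\<^sub>v (2 * p)"
      unfolding z_def T_def by (rule williamson_null_vector[OF S N SNS D c(1) supp])
  qed
qed

lemma positive_definite_diagonal_pos:
  assumes "positive_definite n N" "i < n"
  shows "N $$ (i, i) > 0"
proof -
  have N: "N \<in> carrier_mat n n"
    using assms by (simp add: positive_definite_def)
  have "unit_vec n i \<bullet> (N *\<^sub>v unit_vec n i) > 0"
    using assms unfolding positive_definite_def by auto
  also have "unit_vec n i \<bullet> (N *\<^sub>v unit_vec n i) = N $$ (i, i)"
    using N assms(2) by auto
  finally show ?thesis .
qed


section \<open>Forcing along null vectors\<close>

lemma partner_in_coupling:
  assumes "coupled_graph G C" and v: "v \<in> pverts G"
  shows "partner C v \<noteq> v" "{v, partner C v} \<in> C"
proof -
  have part: "partition_on (pverts G) C" and two: "\<forall>P\<in>C. card P = 2"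
    using assms by (auto simp: coupled_graph_def)
  obtain P where P: "P \<in> C" "v \<in> P"
    using part v by (auto simp: partition_on_def)
  obtain x where x: "x \<noteq> v" "P = {v, x}"
  proof -
    have "card P = 2" using two P(1) by (rule bspec)
    then obtain a b where "P = {a, b}" "a \<noteq> b"
      unfolding card_2_iff by blast
    moreover from this P(2) have "v = a \<or> v = b" by simp
    ultimately show thesis using that[of a] that[of b] by fast
  qed
  have uniq: "w = x" if "w \<noteq> v" "{v, w} \<in> C" for w
  proof -
    have "{v, w} = P"
      using part that(2) P disjointD[of C "{v, w}" P] by (meson disjoint_iff insertI1 partition_onD2)
    then show ?thesis using x that(1) by (simp add: doubleton_eq_iff)
  qed
  have vx: "{v, x} \<in> C"
    using P(1) x(2) by simp
  have "partner C v = x"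
    unfolding partner_def using x(1) vx uniq by blast
  then show "partner C v \<noteq> v" "{v, partner C v} \<in> C"
    using x(1) vx by simp_all
qed

lemma coupled_nbhd_subset:
  assumes "coupled_graph G C" "v \<in> pverts G"
  shows "coupled_nbhd G C v \<subseteq> pverts G - {v}"
proof -
  interpret pair_graph G using assms by (simp add: coupled_graph_def)
  have "partner C v \<in> pverts G"
    using partner_in_coupling(2)[OF assms] assms(1)
    by (auto simp: coupled_graph_def partition_on_def)
  then show ?thesis
    using partner_in_coupling(1)[OF assms] in_arcsD2 no_loops
    by (fastforce simp: coupled_nbhd_def)
qed

lemma Omega_labels_nonzero_iff:
  assumes G: "coupled_graph G C" and L: "representative_labeling G C L"
    and u: "u \<in> pverts G" and v: "v \<in> pverts G"
  shows "Omega (card C) $$ (L u, L v) \<noteq> 0 \<longleftrightarrow> v = partner C u"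
proof -
  let ?p = "card C"
  have bij: "bij_betw L (pverts G) {..<2 * ?p}"
    using L by (simp add: representative_labeling_def)
  have lt: "L u < 2 * ?p" "L v < 2 * ?p"
    using bij u v by (auto simp: bij_betw_def)
  let ?w = "partner C u"
  have w: "?w \<in> pverts G" "?w \<noteq> u"
    using coupled_nbhd_subset[OF G u] by (auto simp: coupled_nbhd_def)
  obtain k where k: "k < ?p" "L ` {u, ?w} = {k, k + ?p}"
    using L partner_in_coupling(2)[OF G u] by (auto simp: representative_labeling_def)
  have "L u \<noteq> L ?w"
    using bij u w by (auto simp: bij_betw_def inj_on_def)
  then have "L u = k \<and> L ?w = k + ?p \<or> L u = k + ?p \<and> L ?w = k"
    using k(2) by (auto simp: doubleton_eq_iff)
  then have "(L v = L u + ?p \<or> L u = L v + ?p) \<longleftrightarrow> L v = L ?w"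
    using lt k(1) by auto
  also have "\<dots> \<longleftrightarrow> v = ?w"
    using bij v w by (auto simp: bij_betw_def inj_on_def)
  finally show ?thesis
    using Omega_nonzero_iff[OF lt] by simp
qed

text \<open>
  Under either rule, exactly one vertex \<open>x\<close> of \<open>{v} \<union> coupled_nbhd G C v\<close> is white, so that row \<open>v\<close>
  of \<open>A z = 0\<close> reads \<open>A\<^sub>v\<^sub>x z\<^sub>x = 0\<close>. The second rule relies on the diagonal entry being nonzero.
\<close>

lemma null_vector_color_change:
  fixes A :: "'b :: idom mat"
  assumes G: "coupled_graph G C" and L: "bij_betw L (pverts G) {..<n}"
    and A: "A \<in> carrier_mat n n" and z: "z \<in> carrier_vec n" "A *\<^sub>v z = 0\<^sub>v n"
    and pattern: "\<And>u v. u \<in> pverts G \<Longrightarrow> v \<in> pverts G \<Longrightarrow>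
      A $$ (L u, L v) \<noteq> 0 \<longleftrightarrow> v = u \<or> v \<in> coupled_nbhd G C u"
    and B: "color_change G C B B'" "\<forall>b\<in>B. z $ L b = 0"
  shows "\<forall>b\<in>B'. z $ L b = 0"
proof -
  have fin: "finite (pverts G)"
    using L by (simp add: bij_betw_finite)
  have forced: "z $ L x = 0"
    if v: "v \<in> pverts G" and white: "insert v (coupled_nbhd G C v) - B = {x}" for v x
  proof -
    have x: "x \<in> pverts G" "x = v \<or> x \<in> coupled_nbhd G C v"
      using white v coupled_nbhd_subset[OF G v] by auto
    have Lv: "L v < n" using L v by (auto simp: bij_betw_def)
    have "0 = (A *\<^sub>v z) $ L v" using z Lv by simp
    also have "\<dots> = (\<Sum>j\<in>{..<n}. A $$ (L v, j) * z $ j)"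
      using A z(1) Lv by (auto simp: scalar_prod_def atLeast0LessThan)
    also have "\<dots> = (\<Sum>u\<in>pverts G. A $$ (L v, L u) * z $ L u)"
      using sum.reindex_bij_betw[OF L, of "\<lambda>j. A $$ (L v, j) * z $ j"] by simp
    also have "\<dots> = (\<Sum>u\<in>{x}. A $$ (L v, L u) * z $ L u)"
    proof (rule sum.mono_neutral_right[OF fin])
      show "\<forall>u\<in>pverts G - {x}. A $$ (L v, L u) * z $ L u = 0"
      proof
        fix u assume u: "u \<in> pverts G - {x}"
        show "A $$ (L v, L u) * z $ L u = 0"
        proof (cases "u \<in> B")
          case False
          then have "\<not> (u = v \<or> u \<in> coupled_nbhd G C v)"
            using u white by auto
          then show ?thesis using pattern[OF v] u by auto
        qed (use B(2) in auto)
      qed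
    qed (use x in auto)
    finally show ?thesis
      using pattern[OF v x(1)] x(2) by auto
  qed
  show ?thesis
    using B(1)
  proof cases
    case (force_neighbor v w)
    then have "insert v (coupled_nbhd G C v) - B = {w}" by auto
    then show ?thesis using forced force_neighbor B(2) by auto
  next
    case (force_self v)
    then have "insert v (coupled_nbhd G C v) - B = {v}" by auto
    then show ?thesis using forced force_self B(2) by auto
  qed
qed

text \<open>
  The real part of \<open>A\<close> is \<open>N\<close> and its imaginary part is \<open>l \<Omega>\<close>, so adjacency and coupling cannot
  cancel each other in an entry of \<open>A\<close>.
\<close>

lemma symplectic_eigenvalue_mult_le_card_zero_forcing_set:
  assumes G: "coupled_graph G C" and L: "representative_labeling G C L"
    and N: "N \<in> S_plus G C L" and mult: "symplectic_eigenvalue_mult (card C) N l m"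
    and B: "coupled_zero_forcing_set G C B"
  shows "m \<le> card B"
proof (rule ccontr)
  assume "\<not> m \<le> card B"
  define n where "n = 2 * card C"
  define A where
    "A = map_mat complex_of_real N +
      (\<i> * complex_of_real l) \<cdot>\<^sub>m map_mat complex_of_real (Omega (card C))"
  have bij: "bij_betw L (pverts G) {..<n}"
    using L by (simp add: representative_labeling_def n_def)
  have BV: "B \<subseteq> pverts G" and force: "(color_change G C)\<^sup>*\<^sup>* B (pverts G)"
    using B by (auto simp: coupled_zero_forcing_set_def)
  have pd: "positive_definite n N"
    and adj: "\<And>u v. u \<in> pverts G \<Longrightarrow> v \<in> pverts G \<Longrightarrow> u \<noteq> v \<Longrightarrow>
      N $$ (L u, L v) \<noteq> 0 \<longleftrightarrow> (u, v) \<in> parcs G"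
    using N by (auto simp: S_plus_def n_def)
  have Nc: "N \<in> carrier_mat n n" using pd by (simp add: positive_definite_def)
  have l: "l > 0"
    using mult
    by (auto simp: symplectic_eigenvalue_mult_def williamson_form_def diag_mat_def)
  have "finite (pverts G)" using bij by (simp add: bij_betw_finite)
  then have "finite B" using BV finite_subset by blast
  then have "finite (L ` B)" "L ` B \<subseteq> {..<n}" "card (L ` B) < m"
    using BV bij \<open>\<not> m \<le> card B\<close> card_image_le[of B L] by (auto simp: bij_betw_def)
  then obtain z where z: "z \<in> carrier_vec n" "z \<noteq> 0\<^sub>v n" "\<forall>k\<in>L ` B. z $ k = 0"
    "A *\<^sub>v z = 0\<^sub>v n"
    using symplectic_eigenvalue_mult_null_vector[OF mult, of "L ` B"] Nc
    unfolding n_def A_def by blast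
  have Ac: "A \<in> carrier_mat n n"
    using Nc by (auto simp: A_def n_def)
  have pattern: "A $$ (L u, L v) \<noteq> 0 \<longleftrightarrow> v = u \<or> v \<in> coupled_nbhd G C u"
    if uv: "u \<in> pverts G" "v \<in> pverts G" for u v
  proof -
    have lt: "L u < n" "L v < n" using bij uv by (auto simp: bij_betw_def)
    have "A $$ (L u, L v) = Complex (N $$ (L u, L v)) (l * Omega (card C) $$ (L u, L v))"
      using lt Nc by (simp add: A_def n_def complex_eq_iff)
    then have *: "A $$ (L u, L v) \<noteq> 0 \<longleftrightarrow> N $$ (L u, L v) \<noteq> 0 \<or> v = partner C u"
      using l Omega_labels_nonzero_iff[OF G L uv] by (auto simp: complex_eq_iff)
    show ?thesis
    proof (cases "v = u")
      case True
      then show ?thesis using * positive_definite_diagonal_pos[OF pd lt(1)] by auto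
    next
      case False
      then show ?thesis using * adj[OF uv] by (auto simp: coupled_nbhd_def)
    qed
  qed
  have "\<forall>b\<in>pverts G. z $ L b = 0"
    using force
  proof induction
    case base
    then show ?case using z(3) by auto
  next
    case (step B' B'')
    then show ?case
      using null_vector_color_change[OF G bij Ac z(1,4) pattern] by blast
  qed
  then have "\<forall>k\<in>{..<n}. z $ k = 0"
    using bij by (metis bij_betw_imp_surj_on imageE)
  then have "z = 0\<^sub>v n"
    using z(1) by (auto intro!: eq_vecI)
  with z(2) show False ..
qed

theorem theorem6p3:
  fixes G :: "'a pair_pre_digraph" and C :: "'a set set" and L :: "'a \<Rightarrow> nat"
  assumes "coupled_graph G C"
    and "representative_labeling G C L"
  shows "M_Sp G C L \<le> Z_C G C"
proof -
  let ?F = "{B. coupled_zero_forcing_set G C B}"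
  let ?M = "{m. \<exists>N\<in>S_plus G C L. \<exists>l. symplectic_eigenvalue_mult (card C) N l m}"
  have "finite (pverts G)"
    using assms(2) bij_betw_finite unfolding representative_labeling_def by blast
  then have "finite ?F"
    by (rule finite_subset[rotated, OF finite_Pow_iff[THEN iffD2]])
      (auto simp: coupled_zero_forcing_set_def)
  moreover have "?F \<noteq> {}"
    by (auto simp: coupled_zero_forcing_set_def)
  ultimately have "Z_C G C \<in> card ` ?F"
    unfolding Z_C_def by (intro Min_in) auto
  then obtain B where B: "coupled_zero_forcing_set G C B" "Z_C G C = card B"
    by auto
  have "m \<le> card B" if "m \<in> ?M" for m
    using that symplectic_eigenvalue_mult_le_card_zero_forcing_set[OF assms _ _ B(1)] by blast
  then have "Sup ?M \<le> card B"
    by (cases "?M = {}") (auto intro: cSup_least)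
  then show ?thesis
    by (simp add: M_Sp_def B(2))
qed

end
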